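(* Let $a_0,a_1$ be masks such that $S_0$ and $S_1$ are interpolatory and the associated adaptive directional subdivision scheme converges, with limit functions $f_\varepsilon$, $\varepsilon\in E_\infty$. For $c\in\ell(\mathbb{Z}^2)$ (any sequence on $\mathbb{Z}^2$), $\varepsilon=(\eta,\tau)\in E$, $\eta\in\{0,1\}^k$, and $n\ge k$, we have $$\sum_{\alpha\in\mathbb{Z}^2}c(\alpha)\,f_{\tau^*}(W_{r(\eta)} W_0^{n-k}\cdot-\alpha)=\sum_{\alpha\in\mathbb{Z}^2}c(W_{r(\eta)}\alpha)\,f_{\varepsilon^*}(W_0^{n-k}\cdot-\alpha)$$ $$\qquad+\sum_{\gamma\in\Gamma_\eta^*}\sum_{\alpha\in\mathbb{Z}^2}\bigl(c-S_\eta D_{W_{r(\eta)}}c\bigr)(W_{r(\eta)}\alpha+\gamma)\,f_{\tau^*}\bigl(W_{r(\eta)}(W_0^{n-k}\cdot-\alpha)-\gamma\bigr).$$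
   Context: Let $W_0=\begin{pmatrix}4&0\\0&2\end{pmatrix}$, $W_1=\begin{pmatrix}4&-4\\0&2\end{pmatrix}$, and $W_\varepsilon=W_{\varepsilon_n}\cdots W_{\varepsilon_1}$ for $\varepsilon=(\varepsilon_1,\dots,\varepsilon_n)\in\{0,1\}^n$. A mask is a finitely supported sequence on $\mathbb{Z}^2$. For $\eta\in\{0,1\}$ let $(S_\eta c)(\alpha)=\sum_{\beta\in\mathbb{Z}^2}a_\eta(\alpha-W_\eta\beta)c(\beta)$, and $S_\varepsilon=S_{\varepsilon_n}\cdots S_{\varepsilon_1}$ for $\varepsilon\in\{0,1\}^n$. $S_\eta$ is interpolatory if $a_\eta(W_\eta\alpha)=\delta_{\alpha,0}$ for all $\alpha\in\mathbb{Z}^2$. Let $E=\bigcup_{n\in\mathbb N}\{0,1\}^n$ be the set of finite $0$-$1$-sequences, $E_\infty=\{0,1\}^{\mathbb{N}}$ with $\mathbb N=\{1,2,\dots\}$, $P_n\varepsilon=(\varepsilon_1,\dots,\varepsilon_n)$, and $\delta(\alpha)=\delta_{\alpha,0}$. The scheme converges if for every $\varepsilon\in E_\infty$ there is a nonzero uniformly continuous function $f_\varepsilon\in C(\mathbb{R}^2)$ (the limit function) with $\lim_{n\to\infty}\sup_{\alpha\in\mathbb{Z}^2}|f_\varepsilon(W_{P_n\varepsilon}^{-1}\alpha)-S_{P_n\varepsilon}\delta(\alpha)|=0$. For a finite $0$-$1$-sequence $\varepsilon$, $\varepsilon^*=(\varepsilon,0,0,\dots)\in E_\infty$. In $\varepsilon=(\eta,\tau)$,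 $\eta$ is the initial segment of length $k$ and $\tau$ the remaining segment. The reversal operator is $r(\varepsilon_1,\dots,\varepsilon_n)=(\varepsilon_n,\dots,\varepsilon_1)$. For a $2\times2$ matrix $M$, $D_Mc=c(M\,\cdot)$. For $\eta\in\{0,1\}^k$, $\Gamma_\eta=\mathbb{Z}^2/W_{r(\eta)}\mathbb{Z}^2$, and $\Gamma_\eta^*$ is a selection of $8^k-1$ representatives for $\Gamma_\eta\setminus\{[0]\}$.
   Formalization: W_{r(η)} is replaced by W_η throughout, including in Γ_η = Z²/W_ηZ²; with the stated product orders the printed identity fails, e.g. for a bilinear interpolatory scheme with η=(0,1), τ empty, n=k=2, c=δ. The two agree when W_η=W_{r(η)}. *)

theory Defs
  imports "HOL-Analysis.Analysis"
begin

text \<open>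
  Binary digits are booleans, with False for 0 and True for 1. A finite word
  (\<epsilon>_1, ..., \<epsilon>_n) is the list [\<epsilon>_1, ..., \<epsilon>_n]. An infinite word is a function
  on nat whose value at i is the digit \<epsilon>_(i+1).
\<close>

definition finite_words :: "bool list set" where
  "finite_words = {\<epsilon>. length \<epsilon> \<ge> 1}"

definition prefix_word :: "nat \<Rightarrow> (nat \<Rightarrow> bool) \<Rightarrow> bool list" where
  "prefix_word n \<epsilon> = map \<epsilon> [0..<n]"

definition zero_ext :: "bool list \<Rightarrow> nat \<Rightarrow> bool" where
  "zero_ext \<epsilon> i = (if i < length \<epsilon> then \<epsilon> ! i else False)"

definition Wmat :: "bool \<Rightarrow> int^2^2" where
  "Wmat e = (if e then vector [vector [4, -4], vector [0, 2]]
                  else vector [vector [4, 0], vector [0, 2]])"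

text \<open>The last digit of the word gives the leftmost factor, in both products below.\<close>

fun Wword :: "bool list \<Rightarrow> int^2^2" where
  "Wword [] = mat 1"
| "Wword (e # \<epsilon>) = Wword \<epsilon> ** Wmat e"

definition subdiv :: "(bool \<Rightarrow> int^2 \<Rightarrow> real) \<Rightarrow> bool \<Rightarrow> (int^2 \<Rightarrow> real) \<Rightarrow> int^2 \<Rightarrow> real" where
  "subdiv a e c \<alpha> = (\<Sum>\<^sub>\<infinity>\<beta>. a e (\<alpha> - Wmat e *v \<beta>) * c \<beta>)"

fun subdiv_word :: "(bool \<Rightarrow> int^2 \<Rightarrow> real) \<Rightarrow> bool list \<Rightarrow> (int^2 \<Rightarrow> real) \<Rightarrow> int^2 \<Rightarrow> real" where
  "subdiv_word a [] c = c"
| "subdiv_word a (e # \<epsilon>) c = subdiv_word a \<epsilon> (subdiv a e c)"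

definition mask :: "(int^2 \<Rightarrow> real) \<Rightarrow> bool" where
  "mask b \<longleftrightarrow> finite {\<alpha>. b \<alpha> \<noteq> 0}"

definition delta :: "int^2 \<Rightarrow> real" where
  "delta \<alpha> = (if \<alpha> = 0 then 1 else 0)"

definition interpolatory :: "(bool \<Rightarrow> int^2 \<Rightarrow> real) \<Rightarrow> bool \<Rightarrow> bool" where
  "interpolatory a e \<longleftrightarrow> (\<forall>\<alpha>. a e (Wmat e *v \<alpha>) = delta \<alpha>)"

definition dilate :: "int^2^2 \<Rightarrow> (int^2 \<Rightarrow> real) \<Rightarrow> int^2 \<Rightarrow> real" where
  "dilate M c = (\<lambda>\<alpha>. c (M *v \<alpha>))"

definition real_vec :: "int^2 \<Rightarrow> real^2" where
  "real_vec v = (\<chi> i. real_of_int (v $ i))"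

definition real_mat :: "int^2^2 \<Rightarrow> real^2^2" where
  "real_mat M = (\<chi> i j. real_of_int (M $ i $ j))"

text \<open>
  The supremum is taken in ereal because an unbounded set of reals has an unspecified
  supremum in type real.
\<close>

definition limit_function ::
  "(bool \<Rightarrow> int^2 \<Rightarrow> real) \<Rightarrow> (nat \<Rightarrow> bool) \<Rightarrow> (real^2 \<Rightarrow> real) \<Rightarrow> bool" where
  "limit_function a \<epsilon> g \<longleftrightarrow>
     g \<noteq> (\<lambda>x. 0) \<and> uniformly_continuous_on UNIV g \<and>
     (\<lambda>n. SUP \<alpha>. ereal \<bar>g (matrix_inv (real_mat (Wword (prefix_word n \<epsilon>))) *v real_vec \<alpha>)
                        - subdiv_word a (prefix_word n \<epsilon>) delta \<alpha>\<bar>) \<longlonglongrightarrow> 0"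

definition converges_with_limits ::
  "(bool \<Rightarrow> int^2 \<Rightarrow> real) \<Rightarrow> ((nat \<Rightarrow> bool) \<Rightarrow> real^2 \<Rightarrow> real) \<Rightarrow> bool" where
  "converges_with_limits a f \<longleftrightarrow> (\<forall>\<epsilon>. limit_function a \<epsilon> (f \<epsilon>))"

definition matrix_power :: "real^2^2 \<Rightarrow> nat \<Rightarrow> real^2^2" where
  "matrix_power M m = (((**) M) ^^ m) (mat 1)"

definition lattice_rel :: "int^2^2 \<Rightarrow> ((int^2) \<times> (int^2)) set" where
  "lattice_rel M = {(\<alpha>, \<beta>). \<exists>\<xi>. \<alpha> - \<beta> = M *v \<xi>}"

text \<open>
  R selects one representative of each nonzero class of \<int>^2 / W_\<eta> \<int>^2.
  The cardinality condition follows from the other two, as every Wmat has determinant 8.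
  The matrix is W_\<eta> and not W_(r(\<eta>)), where r reverses a word: with the product order
  of Wword and subdiv_word, the sequence S_\<eta> c interpolates c on the lattice W_\<eta> \<int>^2,
  and the two factors do not commute.
\<close>

definition nonzero_representatives :: "bool list \<Rightarrow> (int^2) set \<Rightarrow> bool" where
  "nonzero_representatives \<eta> R \<longleftrightarrow>
     (let \<Gamma>' = UNIV // lattice_rel (Wword \<eta>) - {lattice_rel (Wword \<eta>) `` {0}}
      in R \<subseteq> \<Union>\<Gamma>' \<and> (\<forall>X\<in>\<Gamma>'. \<exists>!\<gamma>. \<gamma> \<in> R \<inter> X) \<and> card R = 8 ^ length \<eta> - 1)"

end

theory Submission
  imports Defs
begin

text \<open>
  Write \<open>W\<close> for the matrix of the word \<open>\<eta>\<close>, put \<open>p = S\<^sub>\<eta> D\<^sub>W c\<close>, and fix the point \<open>y\<close> at which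
  the translates are evaluated. The left-hand side pairs \<open>c\<close> with the values
  \<open>g(\<alpha>) = f\<^sub>\<tau>(W y - \<alpha>)\<close>, and the identity comes from splitting \<open>c = p + (c - p)\<close>.

  The prediction \<open>p\<close> gives the coarse term. Iterated subdivision is a convolution,
  \<open>S\<^sub>\<eta> d(\<alpha>) = \<Sum>\<^sub>\<beta> b(\<alpha> - W \<beta>) d(\<beta>)\<close> with the finitely supported symbol \<open>b = S\<^sub>\<eta> \<delta>\<close>
  (\<open>subdiv_word_convolution\<close>), and the limit functions satisfy the refinement equation
  \<open>f\<^sub>\<epsilon>(y) = \<Sum>\<^sub>\<alpha> b(\<alpha>) f\<^sub>\<tau>(W y - \<alpha>)\<close> (\<open>refinement_equation\<close>): after subdividing \<open>\<delta>\<close> along \<open>\<eta>\<close>,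
  one continues along \<open>\<tau>\<close> starting from \<open>b\<close>. Exchanging the order of summation in
  \<open>\<Sum>\<^sub>\<alpha> p(\<alpha>) g(\<alpha>)\<close> and applying the refinement equation collapses the sum over \<open>\<alpha>\<close>
  (\<open>coarse_reconstruction\<close>).

  The error \<open>c - p\<close> gives the detail term. Since the schemes are interpolatory, \<open>p\<close> agrees
  with \<open>c\<close> on the sublattice \<open>W \<int>\<^sup>2\<close> (\<open>subdiv_word_interpolates\<close>), so only the nonzero classes
  modulo \<open>W \<int>\<^sup>2\<close> contribute, and each is parametrised by \<open>\<alpha> \<mapsto> W \<alpha> + \<gamma>\<close>
  (\<open>infsum_lattice_classes\<close>).

  All rearrangements are legitimate because only finitely many translates of \<open>f\<^sub>\<tau>\<close> are nonzero
  at a given point, whatever \<open>c\<close> is (\<open>limit_function_finite_translates\<close>). This compactness of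
  support, like the refinement equation, is read off from the convergence of the scheme: the
  words in question end in zeros, where \<open>W\<^sub>0\<close> is diagonal and expanding, so that the refined
  lattices become dense and the supports of the iterates, once scaled back, stay in a fixed box.
\<close>

section \<open>Sums of finite support\<close>

lemma finite_support_summable:
  fixes g :: "'i \<Rightarrow> real"
  assumes "finite {x. g x \<noteq> 0}"
  shows "g summable_on A"
  by (rule finite_nonzero_values_imp_summable_on)
     (rule finite_subset[OF _ assms], auto)

lemma infsum_finite_support:
  fixes g :: "'i \<Rightarrow> real"
  assumes "finite F" "\<And>x. x \<notin> F \<Longrightarrow> g x = 0"
  shows "infsum g UNIV = sum g F"
proof -
  have "infsum g UNIV = infsum g F"
    by (rule infsum_cong_neutral) (use assms(2) in auto)
  then show ?thesis using assms(1) by simp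
qed

lemma infsum_nonzero_term:
  fixes g :: "'i \<Rightarrow> real"
  assumes "infsum g A \<noteq> 0"
  obtains x where "x \<in> A" "g x \<noteq> 0"
  using assms infsum_0[of A g] by blast

section \<open>Integer and real matrices\<close>

lemma real_mat_mult: "real_mat (M ** N) = real_mat M ** real_mat N"
  by (simp add: real_mat_def matrix_matrix_mult_def vec_eq_iff)

lemma real_vec_mult: "real_vec (M *v v) = real_mat M *v real_vec v"
  by (simp add: real_mat_def real_vec_def matrix_vector_mult_def vec_eq_iff)

lemma real_vec_add: "real_vec (u + v) = real_vec u + real_vec v"
  by (simp add: real_vec_def vec_eq_iff)

lemma real_vec_diff: "real_vec (u - v) = real_vec u - real_vec v"
  by (simp add: real_vec_def vec_eq_iff)

lemma real_mat_1: "real_mat (mat 1) = mat 1"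
  by (simp add: real_mat_def mat_def vec_eq_iff)

lemma inj_real_vec: "inj real_vec"
  by (auto simp: inj_def real_vec_def vec_eq_iff)

lemma invertible_Wword: "invertible (real_mat (Wword w))"
proof (induction w)
  case (Cons e w)
  have "invertible (real_mat (Wmat e))"
    by (cases e) (simp_all add: invertible_det_nz det_2 real_mat_def Wmat_def)
  with Cons show ?case by (simp add: real_mat_mult invertible_mult)
qed (auto simp: real_mat_1 invertible_def intro: exI[of _ "mat 1"])

lemma matrix_inv_Wword:
  "matrix_inv (real_mat (Wword w)) ** real_mat (Wword w) = mat 1"
  "real_mat (Wword w) ** matrix_inv (real_mat (Wword w)) = mat 1"
  using someI_ex[OF invertible_Wword[unfolded invertible_def]]
  by (simp_all add: matrix_inv_def)

lemma matrix_inv_Wword_left [simp]: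
  "matrix_inv (real_mat (Wword w)) *v (real_mat (Wword w) *v x) = x"
  by (simp add: matrix_vector_mul_assoc matrix_inv_Wword)

lemma matrix_inv_Wword_right [simp]:
  "real_mat (Wword w) *v (matrix_inv (real_mat (Wword w)) *v x) = x"
  by (simp add: matrix_vector_mul_assoc matrix_inv_Wword)

lemma inj_Wword: "inj ((*v) (Wword w))"
proof (rule injI)
  fix u v assume "Wword w *v u = Wword w *v v"
  then have "real_mat (Wword w) *v real_vec u = real_mat (Wword w) *v real_vec v"
    by (simp flip: real_vec_mult)
  then have "real_vec u = real_vec v"
    by (metis matrix_inv_Wword_left)
  then show "u = v" using inj_real_vec by (simp add: inj_eq)
qed

lemma Wword_append: "Wword (u @ w) = Wword w ** Wword u"
  by (induction u) (simp_all add: matrix_mul_assoc)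

lemma subdiv_word_append: "subdiv_word a (u @ w) c = subdiv_word a w (subdiv_word a u c)"
  by (induction u arbitrary: c) simp_all

section \<open>Iterated subdivision as a convolution\<close>

text \<open>
  The associativity behind both the composition of subdivision operators and the passage from
  the refinement equation to whole series. Finiteness of the supports of \<open>b\<close> and \<open>g\<close> suffices
  for arbitrary \<open>c\<close>: if \<open>g(\<beta>)\<close> and \<open>b(\<beta> - W \<gamma>)\<close> are both nonzero, then \<open>W \<gamma>\<close> lies in a finite
  set of differences, and \<open>W\<close> is injective.
\<close>
lemma infsum_convolution_swap:
  fixes b c :: "int^2 \<Rightarrow> real"
  assumes "mask b" "finite {\<beta>. g \<beta> \<noteq> 0}" "inj ((*v) W)"
  shows "(\<Sum>\<^sub>\<infinity>\<beta>. g \<beta> * (\<Sum>\<^sub>\<infinity>\<gamma>. b (\<beta> - W *v \<gamma>) * c \<gamma>)) =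
         (\<Sum>\<^sub>\<infinity>\<gamma>. (\<Sum>\<^sub>\<infinity>\<beta>. g (\<beta> + W *v \<gamma>) * b \<beta>) * c \<gamma>)"
proof -
  let ?B = "{\<beta>. g \<beta> \<noteq> 0}" and ?S = "{\<beta>. b \<beta> \<noteq> 0}"
  define h where "h \<beta> \<gamma> = g \<beta> * (b (\<beta> - W *v \<gamma>) * c \<gamma>)" for \<beta> \<gamma>
  let ?C = "(\<lambda>\<gamma>. W *v \<gamma>) -` ((\<lambda>(\<beta>, s). \<beta> - s) ` (?B \<times> ?S))"
  have fin: "finite (?B \<times> ?C)"
    using assms unfolding mask_def
    by (intro finite_cartesian_product finite_vimageI finite_imageI) auto
  have mem: "(\<beta>, \<gamma>) \<in> ?B \<times> ?C" if "h \<beta> \<gamma> \<noteq> 0" for \<beta> \<gamma>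
  proof -
    have "\<beta> \<in> ?B" "\<beta> - W *v \<gamma> \<in> ?S" using that by (auto simp: h_def)
    moreover have "W *v \<gamma> = \<beta> - (\<beta> - W *v \<gamma>)" by simp
    ultimately show ?thesis by blast
  qed
  have "finite {p. (case p of (\<beta>, \<gamma>) \<Rightarrow> h \<beta> \<gamma>) \<noteq> 0}"
    by (rule finite_subset[OF _ fin]) (use mem in auto)
  then have swap: "(\<Sum>\<^sub>\<infinity>\<beta>. \<Sum>\<^sub>\<infinity>\<gamma>. h \<beta> \<gamma>) = (\<Sum>\<^sub>\<infinity>\<gamma>. \<Sum>\<^sub>\<infinity>\<beta>. h \<beta> \<gamma>)"
    by (intro infsum_swap_banach finite_support_summable)
  have "(\<Sum>\<^sub>\<infinity>\<beta>. h \<beta> \<gamma>) = (\<Sum>\<^sub>\<infinity>\<beta>. g (\<beta> + W *v \<gamma>) * b \<beta>) * c \<gamma>" for \<gamma>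
  proof -
    have "(\<Sum>\<^sub>\<infinity>\<beta>. h \<beta> \<gamma>) = (\<Sum>\<^sub>\<infinity>\<beta>. h (\<beta> + W *v \<gamma>) \<gamma>)"
      by (rule infsum_reindex_bij_betw[symmetric]) 
         (auto intro!: bij_betwI[where g = "\<lambda>\<beta>. \<beta> - W *v \<gamma>"])
    also have "\<dots> = (\<Sum>\<^sub>\<infinity>\<beta>. g (\<beta> + W *v \<gamma>) * b \<beta> * c \<gamma>)"
      by (simp add: h_def mult_ac)
    also have "\<dots> = (\<Sum>\<^sub>\<infinity>\<beta>. g (\<beta> + W *v \<gamma>) * b \<beta>) * c \<gamma>"
      by (rule infsum_cmult_left')
    finally show ?thesis .
  qed
  with swap show ?thesis
    by (simp add: h_def infsum_cmult_right')
qed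

lemma mask_subdiv:
  assumes "mask (a e)" "mask c"
  shows "mask (subdiv a e c)"
proof -
  have "{\<alpha>. subdiv a e c \<alpha> \<noteq> 0} \<subseteq> (\<lambda>(s, \<beta>). s + Wmat e *v \<beta>) ` ({\<alpha>. a e \<alpha> \<noteq> 0} \<times> {\<alpha>. c \<alpha> \<noteq> 0})"
  proof
    fix \<alpha> assume "\<alpha> \<in> {\<alpha>. subdiv a e c \<alpha> \<noteq> 0}"
    then obtain \<beta> where "a e (\<alpha> - Wmat e *v \<beta>) * c \<beta> \<noteq> 0"
      by (auto simp: subdiv_def elim: infsum_nonzero_term)
    then show "\<alpha> \<in> (\<lambda>(s, \<beta>). s + Wmat e *v \<beta>) ` ({\<alpha>. a e \<alpha> \<noteq> 0} \<times> {\<alpha>. c \<alpha> \<noteq> 0})"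
      by (intro image_eqI[of _ _ "(\<alpha> - Wmat e *v \<beta>, \<beta>)"]) auto
  qed
  then show ?thesis
    using assms unfolding mask_def by (meson finite_SigmaI finite_imageI finite_subset)
qed

lemma mask_delta: "mask delta"
  by (simp add: mask_def delta_def)

lemma mask_subdiv_word:
  assumes "\<And>e. mask (a e)" "mask c"
  shows "mask (subdiv_word a w c)"
  using assms(2) by (induction w arbitrary: c) (simp_all add: mask_subdiv assms(1))

lemma infsum_delta: "(\<Sum>\<^sub>\<infinity>\<beta>. delta (\<alpha> - \<beta>) * c \<beta>) = c \<alpha>"
  by (subst infsum_finite_support[of "{\<alpha>}"]) (auto simp: delta_def)

lemma infsum_delta': "(\<Sum>\<^sub>\<infinity>\<beta>. c \<beta> * delta \<beta>) = c 0"
  by (subst infsum_finite_support[of "{0}"]) (auto simp: delta_def)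

lemma subdiv_delta: "subdiv a e delta = a e"
  unfolding subdiv_def by (subst infsum_delta') simp

text \<open>
  One step of the induction peels off the first digit: the response of \<open>S\<^sub>w S\<^sub>e\<close> to \<open>\<delta>\<close> is
  \<open>S\<^sub>w\<close> applied to the mask of \<open>e\<close>, because \<open>S\<^sub>e \<delta>\<close> is that mask.
\<close>
lemma subdiv_word_convolution:
  assumes "\<And>e. mask (a e)"
  shows "subdiv_word a w c \<alpha> = (\<Sum>\<^sub>\<infinity>\<beta>. subdiv_word a w delta (\<alpha> - Wword w *v \<beta>) * c \<beta>)"
proof (induction w arbitrary: c \<alpha>)
  case Nil
  show ?case by (simp add: infsum_delta)
next
  case (Cons e w)
  let ?b = "subdiv_word a w delta"
  have fin: "finite {\<beta>. ?b (\<alpha> - Wword w *v \<beta>) \<noteq> 0}"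
  proof -
    have "finite ((\<lambda>\<beta>. \<alpha> - Wword w *v \<beta>) -` {\<gamma>. ?b \<gamma> \<noteq> 0})"
      using mask_subdiv_word[OF assms mask_delta] inj_Wword
      by (intro finite_vimageI) (auto simp: mask_def inj_def)
    then show ?thesis by (simp add: vimage_def)
  qed
  have "subdiv_word a (e # w) c \<alpha> = (\<Sum>\<^sub>\<infinity>\<beta>. ?b (\<alpha> - Wword w *v \<beta>) * subdiv a e c \<beta>)"
    unfolding subdiv_word.simps by (rule Cons)
  also have "\<dots> = (\<Sum>\<^sub>\<infinity>\<gamma>. (\<Sum>\<^sub>\<infinity>\<beta>. ?b (\<alpha> - Wword w *v (\<beta> + Wmat e *v \<gamma>)) * a e \<beta>) * c \<gamma>)"
    unfolding subdiv_def
    by (rule infsum_convolution_swap[OF assms fin]) (use inj_Wword[of "[e]"] in simp)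
  also have "\<dots> = (\<Sum>\<^sub>\<infinity>\<gamma>. subdiv_word a w (a e) (\<alpha> - Wword (e # w) *v \<gamma>) * c \<gamma>)"
    unfolding Cons.IH[of "a e"]
    by (simp add: matrix_vector_right_distrib matrix_vector_mul_assoc algebra_simps)
  finally show ?case by (simp add: subdiv_delta)
qed

text \<open>
  Interpolation passes to words: refining by one digit reproduces the data on the lattice of
  that digit, and the remaining digits then keep these values on its image.
\<close>
lemma subdiv_word_interpolates:
  assumes "\<And>e. interpolatory a e"
  shows "subdiv_word a w c (Wword w *v \<alpha>) = c \<alpha>"
proof (induction w arbitrary: c \<alpha>)
  case (Cons e w)
  have "subdiv a e c (Wmat e *v \<alpha>) = (\<Sum>\<^sub>\<infinity>\<beta>. a e (Wmat e *v (\<alpha> - \<beta>)) * c \<beta>)"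
    by (simp add: subdiv_def matrix_vector_mult_diff_distrib)
  also have "\<dots> = c \<alpha>"
    using assms by (simp add: interpolatory_def infsum_delta)
  finally show ?case using Cons by (simp flip: matrix_vector_mul_assoc)
qed simp

section \<open>Limit functions along refining lattices\<close>

abbreviation zero_padded :: "bool list \<Rightarrow> nat \<Rightarrow> bool list" where
  "zero_padded w j \<equiv> w @ replicate j False"

lemma prefix_word_zero_ext: "prefix_word (length w + j) (zero_ext w) = zero_padded w j"
  by (rule nth_equalityI) (auto simp: prefix_word_def zero_ext_def nth_append)

lemma Wword_replicate_False:
  "real_mat (Wword (replicate j False)) *v v = vector [4 ^ j * v $ 1, 2 ^ j * v $ 2]"
proof (induction j arbitrary: v)
  case 0
  show ?case by (simp add: real_mat_1 vec_eq_iff forall_2)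
next
  case (Suc j)
  have "real_mat (Wmat False) *v v = vector [4 * v $ 1, 2 * v $ 2]"
    by (simp add: real_mat_def Wmat_def matrix_vector_mult_def vec_eq_iff forall_2 sum_2)
  with Suc show ?case by (simp add: real_mat_mult mult_ac flip: matrix_vector_mul_assoc)
qed

lemma matrix_inv_zero_padded:
  "matrix_inv (real_mat (Wword (zero_padded w j))) *v v =
   matrix_inv (real_mat (Wword w)) *v vector [v $ 1 / 4 ^ j, v $ 2 / 2 ^ j]"
proof -
  let ?z = "vector [v $ 1 / 4 ^ j, v $ 2 / 2 ^ j] :: real^2"
  have "real_mat (Wword (zero_padded w j)) *v (matrix_inv (real_mat (Wword w)) *v ?z) = v"
    by (simp add: Wword_append real_mat_mult Wword_replicate_False vec_eq_iff forall_2
        flip: matrix_vector_mul_assoc)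
  then show ?thesis by (metis matrix_inv_Wword_left)
qed

lemma tendsto_floor_scaled:
  fixes b t :: real
  assumes "b > 1"
  shows "(\<lambda>j. of_int \<lfloor>b ^ j * t\<rfloor> / b ^ j) \<longlonglongrightarrow> t"
proof (rule tendsto_sandwich)
  have *: "(\<lambda>j. (1 / b) ^ j) \<longlonglongrightarrow> 0"
    by (rule LIMSEQ_power_zero) (use assms in auto)
  show "(\<lambda>j. t - (1 / b) ^ j) \<longlonglongrightarrow> t"
    using tendsto_diff[OF tendsto_const *] by simp
  show "\<forall>\<^sub>F j in sequentially. t - (1 / b) ^ j \<le> of_int \<lfloor>b ^ j * t\<rfloor> / b ^ j"
  proof (rule always_eventually, rule allI)
    fix j
    have "b ^ j * t - 1 \<le> of_int \<lfloor>b ^ j * t\<rfloor>" by linarith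
    then have "(b ^ j * t - 1) / b ^ j \<le> of_int \<lfloor>b ^ j * t\<rfloor> / b ^ j"
      using assms by (intro divide_right_mono) auto
    then show "t - (1 / b) ^ j \<le> of_int \<lfloor>b ^ j * t\<rfloor> / b ^ j"
      using assms by (simp add: diff_divide_distrib power_one_over)
  qed
  show "\<forall>\<^sub>F j in sequentially. of_int \<lfloor>b ^ j * t\<rfloor> / b ^ j \<le> t"
    using assms by (auto intro!: always_eventually simp: pos_divide_le_eq mult.commute)
qed simp

text \<open>
  The lattices refined along \<open>w\<close> followed by zeros exhaust the plane. Rounding is done in the
  coordinates of \<open>W\<^sub>w x\<close>, where the remaining refinement is the diagonal scaling by
  \<open>4\<^sup>j\<close> and \<open>2\<^sup>j\<close>.
\<close>
lemma lattice_approximation: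
  obtains \<beta> where
    "(\<lambda>j. matrix_inv (real_mat (Wword (zero_padded w j))) *v real_vec (\<beta> j)) \<longlonglongrightarrow> x"
proof -
  let ?z = "real_mat (Wword w) *v x"
  define \<beta> :: "nat \<Rightarrow> int^2" where "\<beta> j = vector [\<lfloor>4 ^ j * ?z $ 1\<rfloor>, \<lfloor>2 ^ j * ?z $ 2\<rfloor>]" for j
  have "(\<lambda>j. vector [real_vec (\<beta> j) $ 1 / 4 ^ j, real_vec (\<beta> j) $ 2 / 2 ^ j] :: real^2) \<longlonglongrightarrow> ?z"
  proof (rule vec_tendstoI)
    fix i :: 2
    show "(\<lambda>j. (vector [real_vec (\<beta> j) $ 1 / 4 ^ j, real_vec (\<beta> j) $ 2 / 2 ^ j] :: real^2) $ i) \<longlonglongrightarrow> ?z $ i"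
      using exhaust_2[of i] by (elim disjE) (simp_all add: \<beta>_def real_vec_def tendsto_floor_scaled)
  qed
  then have "(\<lambda>j. matrix_inv (real_mat (Wword w)) *v
      vector [real_vec (\<beta> j) $ 1 / 4 ^ j, real_vec (\<beta> j) $ 2 / 2 ^ j]) \<longlonglongrightarrow> matrix_inv (real_mat (Wword w)) *v ?z"
    by (rule bounded_linear.tendsto[OF matrix_vector_mul_bounded_linear])
  then show ?thesis by (intro that[of \<beta>]) (simp add: matrix_inv_zero_padded)
qed

text \<open>
  Uniform convergence on the lattices together with continuity of the limit recovers each value
  \<open>g(x)\<close> from the iterates at lattice points approaching \<open>x\<close>. With the preceding density
  statement this determines \<open>g\<close>.
\<close>
lemma limit_function_along:
  assumes "limit_function a (zero_ext w) g"
    and "(\<lambda>j. matrix_inv (real_mat (Wword (zero_padded w j))) *v real_vec (\<beta> j)) \<longlonglongrightarrow> x"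
  shows "(\<lambda>j. subdiv_word a (zero_padded w j) delta (\<beta> j)) \<longlonglongrightarrow> g x"
proof -
  let ?p = "\<lambda>j. matrix_inv (real_mat (Wword (zero_padded w j))) *v real_vec (\<beta> j)"
  let ?s = "\<lambda>j. subdiv_word a (zero_padded w j) delta (\<beta> j)"
  let ?E = "\<lambda>j. SUP \<alpha>. ereal \<bar>g (matrix_inv (real_mat (Wword (zero_padded w j))) *v real_vec \<alpha>)
                        - subdiv_word a (zero_padded w j) delta \<alpha>\<bar>"
  have "(\<lambda>n. SUP \<alpha>. ereal \<bar>g (matrix_inv (real_mat (Wword (prefix_word n (zero_ext w)))) *v real_vec \<alpha>)
                        - subdiv_word a (prefix_word n (zero_ext w)) delta \<alpha>\<bar>) \<longlonglongrightarrow> 0"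
    using assms(1) by (simp add: limit_function_def)
  from LIMSEQ_ignore_initial_segment[OF this, of "length w"]
  have "?E \<longlonglongrightarrow> 0"
    by (simp only: add.commute[of _ "length w"] prefix_word_zero_ext)
  then have "(\<lambda>j. ereal \<bar>g (?p j) - ?s j\<bar>) \<longlonglongrightarrow> 0"
    by (rule tendsto_sandwich[OF _ _ tendsto_const, rotated 2]) 
       (auto intro!: always_eventually SUP_upper)
  then have d: "(\<lambda>j. g (?p j) - ?s j) \<longlonglongrightarrow> 0"
    by (simp add: zero_ereal_def tendsto_rabs_zero_iff)
  have "isCont g x"
    using assms(1) uniformly_continuous_imp_continuous
    unfolding limit_function_def by (metis UNIV_I continuous_on_eq_continuous_at open_UNIV)
  then have "(\<lambda>j. g (?p j)) \<longlonglongrightarrow> g x"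
    using assms(2) by (rule isCont_tendsto_compose)
  from tendsto_diff[OF this d] show ?thesis by simp
qed

text \<open>
  Along lattice points \<open>\<beta>\<^sub>j\<close> that approach \<open>x\<close> for the word \<open>u w 0\<^sup>j\<close>, the iterate is a fixed finite
  combination of iterates for \<open>w 0\<^sup>j\<close> at the points \<open>\<beta>\<^sub>j - W \<alpha>\<close>, with \<open>W\<close> the matrix of \<open>w 0\<^sup>j\<close>.
  Seen through the word \<open>w 0\<^sup>j\<close> alone, these points approach \<open>W\<^sub>u x - \<alpha>\<close>, so passing to the limit
  on both sides gives the equation.
\<close>
lemma refinement_equation:
  assumes "\<And>e. mask (a e)" "converges_with_limits a f"
  shows "f (zero_ext (u @ w)) x =
    (\<Sum>\<^sub>\<infinity>\<alpha>. subdiv_word a u delta \<alpha> * f (zero_ext w) (real_mat (Wword u) *v x - real_vec \<alpha>))"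
proof -
  let ?b = "subdiv_word a u delta"
  have lim: "limit_function a (zero_ext v) (f (zero_ext v))" for v
    using assms(2) by (simp add: converges_with_limits_def)
  have fin: "finite {\<alpha>. ?b \<alpha> \<noteq> 0}"
    using mask_subdiv_word[OF assms(1) mask_delta] by (simp add: mask_def)
  obtain \<beta> where \<beta>:
    "(\<lambda>j. matrix_inv (real_mat (Wword (zero_padded (u @ w) j))) *v real_vec (\<beta> j)) \<longlonglongrightarrow> x"
    using lattice_approximation .
  have lhs: "(\<lambda>j. subdiv_word a (zero_padded (u @ w) j) delta (\<beta> j)) \<longlonglongrightarrow> f (zero_ext (u @ w)) x"
    by (rule limit_function_along[OF lim \<beta>])
  have shifted: "(\<lambda>j. subdiv_word a (zero_padded w j) delta (\<beta> j - Wword (zero_padded w j) *v \<alpha>))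
      \<longlonglongrightarrow> f (zero_ext w) (real_mat (Wword u) *v x - real_vec \<alpha>)" for \<alpha>
  proof (rule limit_function_along[OF lim])
    have "matrix_inv (real_mat (Wword (zero_padded w j))) *v
            real_vec (\<beta> j - Wword (zero_padded w j) *v \<alpha>) =
          real_mat (Wword u) *v (matrix_inv (real_mat (Wword (zero_padded (u @ w) j))) *v real_vec (\<beta> j))
            - real_vec \<alpha>" for j
    proof -
      let ?y = "matrix_inv (real_mat (Wword (zero_padded (u @ w) j))) *v real_vec (\<beta> j)"
      have "real_vec (\<beta> j) = real_mat (Wword (u @ zero_padded w j)) *v ?y"
        using matrix_inv_Wword_right[of "zero_padded (u @ w) j"] by simp
      also have "\<dots> = real_mat (Wword (zero_padded w j)) *v (real_mat (Wword u) *v ?y)"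
        by (subst Wword_append) (simp add: real_mat_mult flip: matrix_vector_mul_assoc)
      finally have "real_vec (\<beta> j - Wword (zero_padded w j) *v \<alpha>) =
          real_mat (Wword (zero_padded w j)) *v (real_mat (Wword u) *v ?y - real_vec \<alpha>)"
        by (simp add: real_vec_diff real_vec_mult matrix_vector_mult_diff_distrib)
      then show ?thesis by (simp only: matrix_inv_Wword_left)
    qed
    then show "(\<lambda>j. matrix_inv (real_mat (Wword (zero_padded w j))) *v
        real_vec (\<beta> j - Wword (zero_padded w j) *v \<alpha>)) \<longlonglongrightarrow> real_mat (Wword u) *v x - real_vec \<alpha>"
      by (simp only:) (intro tendsto_diff tendsto_const bounded_linear.tendsto[OF matrix_vector_mul_bounded_linear] \<beta>)
  qed
  have "subdiv_word a (zero_padded (u @ w) j) delta (\<beta> j) =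
    (\<Sum>\<alpha> | ?b \<alpha> \<noteq> 0. ?b \<alpha> * subdiv_word a (zero_padded w j) delta (\<beta> j - Wword (zero_padded w j) *v \<alpha>))" for j
  proof -
    have "subdiv_word a (zero_padded (u @ w) j) delta (\<beta> j) = subdiv_word a (zero_padded w j) ?b (\<beta> j)"
      by (simp add: subdiv_word_append)
    also have "\<dots> = (\<Sum>\<^sub>\<infinity>\<alpha>. subdiv_word a (zero_padded w j) delta (\<beta> j - Wword (zero_padded w j) *v \<alpha>) * ?b \<alpha>)"
      by (rule subdiv_word_convolution[OF assms(1)])
    also have "\<dots> = (\<Sum>\<alpha> | ?b \<alpha> \<noteq> 0. subdiv_word a (zero_padded w j) delta (\<beta> j - Wword (zero_padded w j) *v \<alpha>) * ?b \<alpha>)"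
      by (rule infsum_finite_support[OF fin]) simp
    finally show ?thesis by (simp only: mult.commute)
  qed
  then have "(\<lambda>j. subdiv_word a (zero_padded (u @ w) j) delta (\<beta> j)) \<longlonglongrightarrow>
    (\<Sum>\<alpha> | ?b \<alpha> \<noteq> 0. ?b \<alpha> * f (zero_ext w) (real_mat (Wword u) *v x - real_vec \<alpha>))"
    by (simp only:) (intro tendsto_sum tendsto_mult tendsto_const shifted)
  from LIMSEQ_unique[OF lhs this] show ?thesis
    by (subst infsum_finite_support[OF fin]) auto
qed

section \<open>Compact support of the limit functions\<close>

lemma subdiv_False_support:
  assumes a: "\<And>\<alpha>. a False \<alpha> \<noteq> 0 \<Longrightarrow> \<bar>\<alpha> $ 1\<bar> \<le> M \<and> \<bar>\<alpha> $ 2\<bar> \<le> M"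
    and c: "\<And>\<alpha>. c \<alpha> \<noteq> 0 \<Longrightarrow> \<bar>\<alpha> $ 1\<bar> \<le> r \<and> \<bar>\<alpha> $ 2\<bar> \<le> s"
    and nz: "subdiv a False c \<alpha> \<noteq> 0"
  shows "\<bar>\<alpha> $ 1\<bar> \<le> 4 * r + M \<and> \<bar>\<alpha> $ 2\<bar> \<le> 2 * s + M"
proof -
  obtain \<beta> where "a False (\<alpha> - Wmat False *v \<beta>) * c \<beta> \<noteq> 0"
    using nz by (auto simp: subdiv_def elim: infsum_nonzero_term)
  then have "\<bar>(\<alpha> - Wmat False *v \<beta>) $ 1\<bar> \<le> M \<and> \<bar>(\<alpha> - Wmat False *v \<beta>) $ 2\<bar> \<le> M"
    "\<bar>\<beta> $ 1\<bar> \<le> r \<and> \<bar>\<beta> $ 2\<bar> \<le> s"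
    using a[of "\<alpha> - Wmat False *v \<beta>"] c[of \<beta>] by simp_all
  then show ?thesis
    by (simp add: Wmat_def matrix_vector_mult_def sum_2) linarith
qed

text \<open>
  Measuring the initial box as \<open>r - M\<close>, with \<open>M\<close> bounding the mask, turns the recursions
  \<open>s \<mapsto> 4 s + M\<close> and \<open>s \<mapsto> 2 s + M\<close> into bounds that grow exactly like the scaling of the lattice:
  \<open>4 (q - M) + M\<close> and \<open>2 (q - M) + M\<close> are at most \<open>4 q - M\<close> and \<open>2 q - M\<close>.
\<close>
lemma subdiv_replicate_False_support:
  assumes a: "\<And>\<alpha>. a False \<alpha> \<noteq> 0 \<Longrightarrow> \<bar>\<alpha> $ 1\<bar> \<le> M \<and> \<bar>\<alpha> $ 2\<bar> \<le> M" and "M \<ge> 0"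
    and c: "\<And>\<alpha>. c \<alpha> \<noteq> 0 \<Longrightarrow> \<bar>\<alpha> $ 1\<bar> \<le> r - M \<and> \<bar>\<alpha> $ 2\<bar> \<le> r - M"
    and nz: "subdiv_word a (replicate j False) c \<alpha> \<noteq> 0"
  shows "\<bar>\<alpha> $ 1\<bar> \<le> 4 ^ j * r - M \<and> \<bar>\<alpha> $ 2\<bar> \<le> 2 ^ j * r - M"
  using nz
proof (induction j arbitrary: \<alpha>)
  case (Suc j)
  have "subdiv_word a (replicate (Suc j) False) c = subdiv a False (subdiv_word a (replicate j False) c)"
    by (simp only: replicate_Suc flip: replicate_append_same) (simp add: subdiv_word_append)
  with Suc.prems have "subdiv a False (subdiv_word a (replicate j False) c) \<alpha> \<noteq> 0" by simp
  from subdiv_False_support[OF a Suc.IH this] \<open>M \<ge> 0\<close> show ?case by simp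
qed (use c in simp)

lemma mask_bounded:
  assumes "mask b"
  shows "\<exists>M\<ge>0. \<forall>\<alpha>. b \<alpha> \<noteq> 0 \<longrightarrow> \<bar>\<alpha> $ 1\<bar> \<le> M \<and> \<bar>\<alpha> $ 2\<bar> \<le> M"
proof -
  let ?S = "{\<alpha>. b \<alpha> \<noteq> 0}"
  let ?M = "\<Sum>\<alpha>\<in>?S. \<bar>\<alpha> $ 1\<bar> + \<bar>\<alpha> $ 2\<bar>"
  have "\<bar>\<alpha> $ 1\<bar> + \<bar>\<alpha> $ 2\<bar> \<le> ?M" if "b \<alpha> \<noteq> 0" for \<alpha>
    using assms that by (intro member_le_sum) (auto simp: mask_def)
  moreover have "0 \<le> ?M" by (simp add: sum_nonneg)
  ultimately show ?thesis by (intro exI[of _ ?M]) fastforce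
qed

text \<open>
  The box is taken in the coordinates of \<open>W\<^sub>w x\<close>. If \<open>g(x)\<close> is nonzero, the iterates at lattice
  points approaching \<open>x\<close> are eventually nonzero, so these points, scaled back, lie in a box that
  does not depend on the level, and \<open>W\<^sub>w x\<close> is their limit.
\<close>
lemma limit_function_support:
  assumes masks: "\<And>e. mask (a e)" and lim: "limit_function a (zero_ext w) g"
  obtains r where "\<And>x. g x \<noteq> 0 \<Longrightarrow>
    \<bar>(real_mat (Wword w) *v x) $ 1\<bar> \<le> r \<and> \<bar>(real_mat (Wword w) *v x) $ 2\<bar> \<le> r"
proof -
  let ?c = "subdiv_word a w delta"
  obtain M where M: "M \<ge> 0" "\<And>\<alpha>. a False \<alpha> \<noteq> 0 \<Longrightarrow> \<bar>\<alpha> $ 1\<bar> \<le> M \<and> \<bar>\<alpha> $ 2\<bar> \<le> M"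
    using mask_bounded[OF masks] by meson
  obtain N where N: "\<And>\<alpha>. ?c \<alpha> \<noteq> 0 \<Longrightarrow> \<bar>\<alpha> $ 1\<bar> \<le> N \<and> \<bar>\<alpha> $ 2\<bar> \<le> N"
    using mask_bounded[OF mask_subdiv_word[of a delta w, OF masks mask_delta]] by meson
  define r where "r = N + M"
  have box: "\<bar>of_int (\<alpha> $ 1) / 4 ^ j\<bar> \<le> real_of_int r \<and> \<bar>of_int (\<alpha> $ 2) / 2 ^ j\<bar> \<le> real_of_int r"
    if nz: "subdiv_word a (zero_padded w j) delta \<alpha> \<noteq> 0" for \<alpha> :: "int^2" and j
  proof -
    have "\<bar>\<alpha> $ 1\<bar> \<le> 4 ^ j * r - M \<and> \<bar>\<alpha> $ 2\<bar> \<le> 2 ^ j * r - M"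
      by (rule subdiv_replicate_False_support[of a M ?c, OF M(2,1)])
         (use N nz in \<open>auto simp: r_def subdiv_word_append\<close>)
    then have "\<bar>\<alpha> $ 1\<bar> \<le> r * 4 ^ j" "\<bar>\<alpha> $ 2\<bar> \<le> r * 2 ^ j"
      using M(1) by (auto simp: mult.commute)
    then have "real_of_int \<bar>\<alpha> $ 1\<bar> \<le> real_of_int (r * 4 ^ j)" "real_of_int \<bar>\<alpha> $ 2\<bar> \<le> real_of_int (r * 2 ^ j)"
      by (simp_all only: of_int_le_iff)
    then show ?thesis by (simp add: pos_divide_le_eq)
  qed
  have "\<bar>(real_mat (Wword w) *v x) $ 1\<bar> \<le> real_of_int r \<and> \<bar>(real_mat (Wword w) *v x) $ 2\<bar> \<le> real_of_int r"
    if "g x \<noteq> 0" for x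
  proof -
    obtain \<beta> where \<beta>:
      "(\<lambda>j. matrix_inv (real_mat (Wword (zero_padded w j))) *v real_vec (\<beta> j)) \<longlonglongrightarrow> x"
      using lattice_approximation .
    then have "(\<lambda>j. real_mat (Wword w) *v (matrix_inv (real_mat (Wword (zero_padded w j))) *v real_vec (\<beta> j)))
        \<longlonglongrightarrow> real_mat (Wword w) *v x"
      by (rule bounded_linear.tendsto[OF matrix_vector_mul_bounded_linear])
    then have z: "(\<lambda>j. vector [of_int (\<beta> j $ 1) / 4 ^ j, of_int (\<beta> j $ 2) / 2 ^ j] :: real^2)
        \<longlonglongrightarrow> real_mat (Wword w) *v x"
      by (simp add: matrix_inv_zero_padded real_vec_def)
    have nz: "\<forall>\<^sub>F j in sequentially. subdiv_word a (zero_padded w j) delta (\<beta> j) \<noteq> 0"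
      using limit_function_along[OF lim \<beta>] \<open>g x \<noteq> 0\<close> by (rule tendsto_imp_eventually_ne)
    have ev: "\<forall>\<^sub>F j in sequentially. \<bar>of_int (\<beta> j $ 1) / 4 ^ j\<bar> \<le> real_of_int r"
      "\<forall>\<^sub>F j in sequentially. \<bar>of_int (\<beta> j $ 2) / 2 ^ j\<bar> \<le> real_of_int r"
      by (rule eventually_mono[OF nz], use box in blast)+
    have "(\<lambda>j. \<bar>of_int (\<beta> j $ 1) / 4 ^ j\<bar>) \<longlonglongrightarrow> \<bar>(real_mat (Wword w) *v x) $ 1\<bar>"
      "(\<lambda>j. \<bar>of_int (\<beta> j $ 2) / 2 ^ j\<bar>) \<longlonglongrightarrow> \<bar>(real_mat (Wword w) *v x) $ 2\<bar>"
      using tendsto_rabs[OF tendsto_vec_nth[OF z, of 1]] tendsto_rabs[OF tendsto_vec_nth[OF z, of 2]]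
      by simp_all
    from tendsto_upperbound[OF this(1) ev(1)] tendsto_upperbound[OF this(2) ev(2)] show ?thesis
      by simp
  qed
  then show ?thesis by (rule that)
qed

lemma limit_function_finite_translates:
  assumes masks: "\<And>e. mask (a e)" and lim: "limit_function a (zero_ext w) g"
  shows "finite {\<alpha>. g (y - real_vec \<alpha>) \<noteq> 0}"
proof -
  obtain r where r: "\<And>x. g x \<noteq> 0 \<Longrightarrow>
    \<bar>(real_mat (Wword w) *v x) $ 1\<bar> \<le> r \<and> \<bar>(real_mat (Wword w) *v x) $ 2\<bar> \<le> r"
    using limit_function_support[OF assms] by blast
  let ?z = "real_mat (Wword w) *v y"
  let ?box = "\<lambda>i. {\<lfloor>?z $ i - r\<rfloor> .. \<lceil>?z $ i + r\<rceil>}"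
  let ?F = "(\<lambda>(s, t). vector [s, t] :: int^2) ` (?box 1 \<times> ?box 2)"
  have "{\<alpha>. g (y - real_vec \<alpha>) \<noteq> 0} \<subseteq> (*v) (Wword w) -` ?F"
  proof
    fix \<alpha> assume "\<alpha> \<in> {\<alpha>. g (y - real_vec \<alpha>) \<noteq> 0}"
    then have "\<bar>(?z - real_vec (Wword w *v \<alpha>)) $ 1\<bar> \<le> r \<and> \<bar>(?z - real_vec (Wword w *v \<alpha>)) $ 2\<bar> \<le> r"
      using r[of "y - real_vec \<alpha>"] by (simp add: real_vec_mult matrix_vector_mult_diff_distrib)
    then have "(Wword w *v \<alpha>) $ 1 \<in> ?box 1" "(Wword w *v \<alpha>) $ 2 \<in> ?box 2"
      by (simp_all add: real_vec_def) linarith+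
    moreover have "Wword w *v \<alpha> = vector [(Wword w *v \<alpha>) $ 1, (Wword w *v \<alpha>) $ 2]"
      by (simp add: vec_eq_iff forall_2)
    ultimately show "\<alpha> \<in> (*v) (Wword w) -` ?F" by force
  qed
  moreover have "finite ((*v) (Wword w) -` ?F)"
    by (intro finite_vimageI inj_Wword) auto
  ultimately show ?thesis by (rule finite_subset)
qed

section \<open>Decomposition of the lattice into classes\<close>

lemma equiv_lattice_rel: "equiv UNIV (lattice_rel W)"
proof (rule equivI)
  show "refl_on UNIV (lattice_rel W)"
    by (auto simp: refl_on_def lattice_rel_def intro: exI[of _ 0])
  show "sym (lattice_rel W)"
  proof (rule symI)
    fix x y assume "(x, y) \<in> lattice_rel W"
    then obtain \<xi> where "x - y = W *v \<xi>" by (auto simp: lattice_rel_def)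
    then have "y - x = W *v (0 - \<xi>)" by (simp only: matrix_vector_mult_diff_distrib) (simp add: algebra_simps)
    then show "(y, x) \<in> lattice_rel W" by (auto simp: lattice_rel_def)
  qed
  show "trans (lattice_rel W)"
  proof (rule transI)
    fix x y z assume "(x, y) \<in> lattice_rel W" "(y, z) \<in> lattice_rel W"
    then obtain \<xi> \<zeta> where "x - y = W *v \<xi>" "y - z = W *v \<zeta>" by (auto simp: lattice_rel_def)
    then have "x - z = W *v (\<xi> + \<zeta>)" by (simp add: matrix_vector_right_distrib algebra_simps)
    then show "(x, z) \<in> lattice_rel W" by (auto simp: lattice_rel_def)
  qed
qed simp

lemma representatives_bij_betw:
  assumes "nonzero_representatives w R"
  shows "bij_betw (\<lambda>(\<gamma>, \<alpha>). Wword w *v \<alpha> + \<gamma>) (R \<times> UNIV) (- range ((*v) (Wword w)))"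
proof -
  let ?W = "Wword w" and ?L = "lattice_rel (Wword w)"
  let ?G = "UNIV // ?L - {?L `` {0}}"
  note eq = equiv_lattice_rel[of ?W]
  have R: "R \<subseteq> \<Union>?G" and ex1: "\<And>X. X \<in> ?G \<Longrightarrow> \<exists>!\<gamma>. \<gamma> \<in> R \<inter> X"
    using assms by (auto simp: nonzero_representatives_def Let_def)
  have zero_class: "?L `` {0} = range ((*v) ?W)"
  proof -
    have "(0, v) \<in> ?L \<longleftrightarrow> v \<in> range ((*v) ?W)" for v
    proof -
      have "(0, v) \<in> ?L \<longleftrightarrow> (v, 0) \<in> ?L" using eq by (meson equivE symE)
      then show ?thesis by (auto simp: lattice_rel_def)
    qed
    then show ?thesis by auto
  qed
  have disj: "X \<inter> range ((*v) ?W) = {}" if "X \<in> ?G" for X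
  proof -
    have "?L `` {0} \<in> UNIV // ?L" by (rule quotientI) simp
    then show ?thesis using quotient_disj[OF eq, of X "?L `` {0}"] that zero_class by blast
  qed
  have cls: "?L `` {\<gamma>} \<in> ?G" if "\<gamma> \<notin> range ((*v) ?W)" for \<gamma>
  proof -
    have "\<gamma> \<in> ?L `` {\<gamma>}" by (rule equiv_class_self[OF eq]) simp
    then show ?thesis using that zero_class by (auto simp: quotientI)
  qed
  have related: "(?W *v \<alpha> + \<gamma>, \<gamma>) \<in> ?L" for \<alpha> \<gamma>
    by (auto simp: lattice_rel_def)
  have notin: "?W *v \<alpha> + \<gamma> \<notin> range ((*v) ?W)" if \<gamma>: "\<gamma> \<in> R" for \<alpha> \<gamma>
  proof
    assume "?W *v \<alpha> + \<gamma> \<in> range ((*v) ?W)"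
    then obtain \<xi> where "?W *v \<alpha> + \<gamma> = ?W *v \<xi>" by auto
    then have "\<gamma> = ?W *v (\<xi> - \<alpha>)" by (simp add: matrix_vector_mult_diff_distrib algebra_simps)
    moreover obtain X where "X \<in> ?G" "\<gamma> \<in> X" using R \<gamma> by blast
    ultimately show False using disj by blast
  qed
  show ?thesis
  proof (rule bij_betw_imageI)
    show "inj_on (\<lambda>(\<gamma>, \<alpha>). ?W *v \<alpha> + \<gamma>) (R \<times> UNIV)"
    proof (clarsimp simp: inj_on_def)
      fix \<gamma> \<alpha> \<gamma>' \<alpha>'
      assume \<gamma>: "\<gamma> \<in> R" "\<gamma>' \<in> R" and e: "?W *v \<alpha> + \<gamma> = ?W *v \<alpha>' + \<gamma>'"
      have "?L `` {?W *v \<alpha> + \<gamma>} \<in> ?G" using cls notin \<gamma>(1) by blast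
      moreover have "\<gamma> \<in> ?L `` {?W *v \<alpha> + \<gamma>}" "\<gamma>' \<in> ?L `` {?W *v \<alpha> + \<gamma>}"
        using related[of \<alpha> \<gamma>] related[of \<alpha>' \<gamma>'] e by auto
      ultimately have "\<gamma> = \<gamma>'" using ex1 \<gamma> by blast
      with e show "\<gamma> = \<gamma>' \<and> \<alpha> = \<alpha>'" using inj_Wword[of w] by (auto dest: injD)
    qed
    show "(\<lambda>(\<gamma>, \<alpha>). ?W *v \<alpha> + \<gamma>) ` (R \<times> UNIV) = - range ((*v) ?W)"
    proof
      show "- range ((*v) ?W) \<subseteq> (\<lambda>(\<gamma>, \<alpha>). ?W *v \<alpha> + \<gamma>) ` (R \<times> UNIV)"
      proof
        fix v assume "v \<in> - range ((*v) ?W)"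
        then obtain \<gamma> where "\<gamma> \<in> R" "(v, \<gamma>) \<in> ?L" using ex1[OF cls] by blast
        then obtain \<xi> where "v = ?W *v \<xi> + \<gamma>" by (auto simp: lattice_rel_def algebra_simps)
        with \<open>\<gamma> \<in> R\<close> show "v \<in> (\<lambda>(\<gamma>, \<alpha>). ?W *v \<alpha> + \<gamma>) ` (R \<times> UNIV)" by force
      qed
    qed (use notin in auto)
  qed
qed

text \<open>
  For a nonempty word the prescribed cardinality is positive, which forces finiteness. For the
  empty word the prescribed cardinality is zero, which an infinite set would also have; there
  the sublattice is everything and no class remains to be represented.
\<close>
lemma representatives_finite:
  assumes "nonzero_representatives w R"
  shows "finite R"
proof (cases w)
  case Nil
  then have "range ((*v) (Wword w)) = UNIV" by auto
  then have "R \<times> (UNIV :: (int^2) set) = {}"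
    using representatives_bij_betw[OF assms] by (simp add: bij_betw_def)
  then show ?thesis by auto
next
  case (Cons e v)
  have "(8::nat) ^ length w > 1" using Cons by (intro one_less_power) auto
  then have "card R > 0" using assms by (simp add: nonzero_representatives_def Let_def)
  then show ?thesis by (simp add: card_gt_0_iff)
qed

lemma infsum_lattice_classes:
  fixes G :: "int^2 \<Rightarrow> real"
  assumes R: "nonzero_representatives w R"
    and fin: "finite {\<alpha>. G \<alpha> \<noteq> 0}" and zero: "\<And>\<alpha>. G (Wword w *v \<alpha>) = 0"
  shows "infsum G UNIV = (\<Sum>\<gamma>\<in>R. \<Sum>\<^sub>\<infinity>\<alpha>. G (Wword w *v \<alpha> + \<gamma>))"
proof -
  let ?h = "\<lambda>(\<gamma>, \<alpha>). Wword w *v \<alpha> + \<gamma>"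
  note bij = representatives_bij_betw[OF R]
  have "infsum G UNIV = infsum G (- range ((*v) (Wword w)))"
    by (rule infsum_cong_neutral) (use zero in auto)
  also have "\<dots> = (\<Sum>\<^sub>\<infinity>p\<in>R \<times> UNIV. G (?h p))"
    by (rule infsum_reindex_bij_betw[OF bij, symmetric])
  also have "\<dots> = (\<Sum>\<^sub>\<infinity>(\<gamma>, \<alpha>)\<in>R \<times> UNIV. G (Wword w *v \<alpha> + \<gamma>))"
    by (simp add: case_prod_unfold)
  also have "\<dots> = (\<Sum>\<^sub>\<infinity>\<gamma>\<in>R. \<Sum>\<^sub>\<infinity>\<alpha>. G (Wword w *v \<alpha> + \<gamma>))"
  proof (rule infsum_Sigma'_banach[symmetric])
    have "(\<lambda>p. G (?h p)) summable_on R \<times> UNIV"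
      by (subst summable_on_reindex_bij_betw[OF bij]) (rule finite_support_summable[OF fin])
    then show "(\<lambda>(\<gamma>, \<alpha>). G (Wword w *v \<alpha> + \<gamma>)) summable_on R \<times> UNIV"
      by (simp add: case_prod_unfold)
  qed
  also have "\<dots> = (\<Sum>\<gamma>\<in>R. \<Sum>\<^sub>\<infinity>\<alpha>. G (Wword w *v \<alpha> + \<gamma>))"
    using representatives_finite[OF R] by simp
  finally show ?thesis .
qed

section \<open>The reconstruction identity\<close>

text \<open>
  Expanding \<open>S\<^sub>\<eta> d\<close> as a convolution and summing over the fine index first leaves, for each
  coarse index \<open>\<beta>\<close>, exactly the refinement equation at \<open>y - \<beta>\<close>.
\<close>
lemma coarse_reconstruction:
  assumes masks: "\<And>e. mask (a e)" and conv: "converges_with_limits a f"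
  shows "(\<Sum>\<^sub>\<infinity>\<alpha>. subdiv_word a \<eta> d \<alpha> * f (zero_ext \<tau>) (real_mat (Wword \<eta>) *v y - real_vec \<alpha>)) =
    (\<Sum>\<^sub>\<infinity>\<beta>. d \<beta> * f (zero_ext (\<eta> @ \<tau>)) (y - real_vec \<beta>))"
proof -
  let ?b = "subdiv_word a \<eta> delta"
  let ?g = "\<lambda>\<alpha>. f (zero_ext \<tau>) (real_mat (Wword \<eta>) *v y - real_vec \<alpha>)"
  have fin: "finite {\<alpha>. ?g \<alpha> \<noteq> 0}"
    using conv by (intro limit_function_finite_translates[of a \<tau>, OF masks]) (simp add: converges_with_limits_def)
  have "(\<Sum>\<^sub>\<infinity>\<alpha>. subdiv_word a \<eta> d \<alpha> * ?g \<alpha>) =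
      (\<Sum>\<^sub>\<infinity>\<alpha>. ?g \<alpha> * (\<Sum>\<^sub>\<infinity>\<beta>. ?b (\<alpha> - Wword \<eta> *v \<beta>) * d \<beta>))"
    by (subst subdiv_word_convolution[OF masks]) (simp add: mult.commute)
  also have "\<dots> = (\<Sum>\<^sub>\<infinity>\<beta>. (\<Sum>\<^sub>\<infinity>\<alpha>. ?g (\<alpha> + Wword \<eta> *v \<beta>) * ?b \<alpha>) * d \<beta>)"
    by (rule infsum_convolution_swap[OF mask_subdiv_word[OF masks mask_delta] fin inj_Wword])
  also have "\<dots> = (\<Sum>\<^sub>\<infinity>\<beta>. d \<beta> * f (zero_ext (\<eta> @ \<tau>)) (y - real_vec \<beta>))"
    by (simp add: refinement_equation[OF masks conv] real_vec_add real_vec_mult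
        matrix_vector_mult_diff_distrib mult.commute algebra_simps)
  finally show ?thesis .
qed

theorem theorem7p3:
  fixes a :: "bool \<Rightarrow> int^2 \<Rightarrow> real"
    and f :: "(nat \<Rightarrow> bool) \<Rightarrow> real^2 \<Rightarrow> real"
    and c :: "int^2 \<Rightarrow> real"
    and \<epsilon> \<eta> \<tau> :: "bool list"
    and k n :: nat
    and R :: "(int^2) set"
  assumes "\<And>e. mask (a e)"
    and "\<And>e. interpolatory a e"
    and "converges_with_limits a f"
    and "\<epsilon> \<in> finite_words"
    and "\<epsilon> = \<eta> @ \<tau>"
    and "length \<eta> = k"
    and "n \<ge> k"
    and "nonzero_representatives \<eta> R"
  shows
    "(\<lambda>x. \<Sum>\<^sub>\<infinity>\<alpha>. c \<alpha> *
        f (zero_ext \<tau>) (real_mat (Wword \<eta>) *v (matrix_power (real_mat (Wmat False)) (n - k) *v x)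
                        - real_vec \<alpha>)) =
     (\<lambda>x. (\<Sum>\<^sub>\<infinity>\<alpha>. c (Wword \<eta> *v \<alpha>) *
             f (zero_ext \<epsilon>) (matrix_power (real_mat (Wmat False)) (n - k) *v x - real_vec \<alpha>))
        + (\<Sum>\<gamma>\<in>R. \<Sum>\<^sub>\<infinity>\<alpha>.
             (c (Wword \<eta> *v \<alpha> + \<gamma>)
                - subdiv_word a \<eta> (dilate (Wword \<eta>) c) (Wword \<eta> *v \<alpha> + \<gamma>)) *
             f (zero_ext \<tau>)
               (real_mat (Wword \<eta>) *v
                  (matrix_power (real_mat (Wmat False)) (n - k) *v x - real_vec \<alpha>)
                - real_vec \<gamma>)))"
proof (rule ext)
  fix x
  define y where "y = matrix_power (real_mat (Wmat False)) (n - k) *v x"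
  let ?W = "Wword \<eta>"
  let ?p = "subdiv_word a \<eta> (dilate ?W c)"
  let ?g = "\<lambda>\<alpha>. f (zero_ext \<tau>) (real_mat ?W *v y - real_vec \<alpha>)"
  have fin: "finite {\<alpha>. ?g \<alpha> \<noteq> 0}"
    using assms(3) by (intro limit_function_finite_translates[of a \<tau>, OF assms(1)])
      (simp add: converges_with_limits_def)
  have finm: "finite {\<alpha>. h \<alpha> * ?g \<alpha> \<noteq> 0}" for h :: "int^2 \<Rightarrow> real"
    by (rule finite_subset[OF _ fin]) auto
  have "(\<Sum>\<^sub>\<infinity>\<alpha>. c \<alpha> * ?g \<alpha>) = (\<Sum>\<^sub>\<infinity>\<alpha>. ?p \<alpha> * ?g \<alpha> + (c \<alpha> - ?p \<alpha>) * ?g \<alpha>)"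
    by (simp add: algebra_simps)
  also have "\<dots> = (\<Sum>\<^sub>\<infinity>\<alpha>. ?p \<alpha> * ?g \<alpha>) + (\<Sum>\<^sub>\<infinity>\<alpha>. (c \<alpha> - ?p \<alpha>) * ?g \<alpha>)"
    by (intro infsum_add finite_support_summable finm)
  also have "(\<Sum>\<^sub>\<infinity>\<alpha>. ?p \<alpha> * ?g \<alpha>) = (\<Sum>\<^sub>\<infinity>\<alpha>. c (?W *v \<alpha>) * f (zero_ext \<epsilon>) (y - real_vec \<alpha>))"
    unfolding coarse_reconstruction[OF assms(1,3)] by (simp add: dilate_def assms(5))
  also have "(\<Sum>\<^sub>\<infinity>\<alpha>. (c \<alpha> - ?p \<alpha>) * ?g \<alpha>) =
      (\<Sum>\<gamma>\<in>R. \<Sum>\<^sub>\<infinity>\<alpha>. (c (?W *v \<alpha> + \<gamma>) - ?p (?W *v \<alpha> + \<gamma>)) * ?g (?W *v \<alpha> + \<gamma>))"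
    by (rule infsum_lattice_classes[OF assms(8) finm])
       (simp add: subdiv_word_interpolates[OF assms(2)] dilate_def)
  finally show "(\<Sum>\<^sub>\<infinity>\<alpha>. c \<alpha> * ?g \<alpha>) =
      (\<Sum>\<^sub>\<infinity>\<alpha>. c (?W *v \<alpha>) * f (zero_ext \<epsilon>) (y - real_vec \<alpha>))
      + (\<Sum>\<gamma>\<in>R. \<Sum>\<^sub>\<infinity>\<alpha>. (c (?W *v \<alpha> + \<gamma>) - ?p (?W *v \<alpha> + \<gamma>)) *
          f (zero_ext \<tau>) (real_mat ?W *v (y - real_vec \<alpha>) - real_vec \<gamma>))"
    by (simp add: real_vec_add real_vec_mult matrix_vector_mult_diff_distrib algebra_simps)
qed

end
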